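(* Let $Q^{(1)}=A_1B_1C_1D_1$ be a quadrilateral, and let $Q^{(2)},Q^{(3)},\dots$ be the successive generations of the perpendicular bisector construction. Then: (1) $Q^{(2)}$ degenerates to a point if and only if $Q^{(1)}$ is cyclic. (2) If $Q^{(1)}$ is not cyclic, the corresponding angles of the first and second generation quadrilaterals are supplementary: $\angle A_1+\angle A_2=\angle B_1+\angle B_2=\angle C_1+\angle C_2=\angle D_1+\angle D_2=\pi$. (3) If $Q^{(1)}$ is not cyclic, all odd generation quadrilaterals are similar to each other and all the even generation quadrilaterals are similar to each other: $Q^{(1)}\sim Q^{(3)}\sim Q^{(5)}\sim\dots$ and $Q^{(2)}\sim Q^{(4)}\sim Q^{(6)}\sim\dots$. Moreover, if $Q^{(1)}$ is not cyclic: (4) All odd generation quadrilaterals are related to each other via spiral similarities with respect to a common center. (5) All even generation quadrilaterals are also related to each other via spiral similarities with respect to a common center. (6) The angle of rotation for each spiral similarity is $\pi$ (for a convex quadrilateral) or $0$ (for a concave quadrilateral). The ratio of similarity is $$r=\tfrac14(\cot\alpha+\cot\gamma)\cdot(\cot\beta+\cot\delta),$$ where $\alpha=\angle A_1$, $\beta=\angle B_1$, $\gamma=\angle C_1$ and $\delta=\angle D_1$ are the angles of $Q^{(1)}$. (7) The center of spiral similarities is the same for both the odd and the even generations.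
   Context: Quadrilaterals are nondegenerate. Perpendicular bisector construction: given $Q^{(n)}=A_nB_nC_nD_n$, the vertices $A_{n+1},B_{n+1},C_{n+1},D_{n+1}$ of $Q^{(n+1)}$ are the circumcenters of the triangles $\triangle D_nA_nB_n$, $\triangle A_nB_nC_n$, $\triangle B_nC_nD_n$, $\triangle C_nD_nA_n$, respectively; that is, $Q^{(n+1)}$ is formed by intersections of the perpendicular bisectors to the sides of $Q^{(n)}$. $Q^{(n)}$ is an odd or even generation according to the parity of $n$. A spiral similarity is the composition of a rotation and a homothety with the same center. The spiral similarities in (6) are those taking a generation $Q^{(n)}$ into $Q^{(n+2)}$, vertices with the same letter corresponding. The ratio $r$ carries a sign: it is negative for convex noncyclic quadrilaterals, corresponding to rotation by $\pi$, and positive for concave ones, corresponding to rotation by $0$.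
   Formalization: Part (2) fails for concave quadrilaterals (e.g. A=i, B=-1, C=2i, D=1), so exact supplementary angles are stated only for convex ones; for every noncyclic quadrilateral (2) is stated with directed angles modulo π, the second generation being measured in the opposite sense. *)

theory Defs
  imports "HOL-Analysis.Analysis" "HOL-Library.Real_Mod"
begin

text \<open>The Euclidean plane is the complex plane. A quadrilateral is the 4-tuple of its vertices in
  cyclic order; \<^term>\<open>map_quad f\<close> moves all vertices, keeping their letters.\<close>

datatype (set_quad: 'a) quad = Quad (vA: 'a) (vB: 'a) (vC: 'a) (vD: 'a)
  for map: map_quad

text \<open>Exactly what is needed for the four circumcenters to exist. Simplicity is not required:
  the results that do not speak of interior angles also hold for crossed quadrilaterals.\<close>

definition nondegenerate :: "complex quad \<Rightarrow> bool" where
  "nondegenerate Q \<longleftrightarrow>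
     \<not> collinear {vD Q, vA Q, vB Q} \<and> \<not> collinear {vA Q, vB Q, vC Q} \<and>
     \<not> collinear {vB Q, vC Q, vD Q} \<and> \<not> collinear {vC Q, vD Q, vA Q}"

definition cyclic :: "complex quad \<Rightarrow> bool" where
  "cyclic Q \<longleftrightarrow> (\<exists>M R. \<forall>P \<in> set_quad Q. dist M P = R)"

text \<open>A sensible point only if the three arguments are not collinear.\<close>

definition circumcenter :: "complex \<Rightarrow> complex \<Rightarrow> complex \<Rightarrow> complex" where
  "circumcenter X Y Z = (THE P. dist P X = dist P Y \<and> dist P Y = dist P Z)"

definition pb_step :: "complex quad \<Rightarrow> complex quad" where
  "pb_step Q = Quad
     (circumcenter (vD Q) (vA Q) (vB Q))
     (circumcenter (vA Q) (vB Q) (vC Q))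
     (circumcenter (vB Q) (vC Q) (vD Q))
     (circumcenter (vC Q) (vD Q) (vA Q))"

text \<open>The angle in $[0, 2\pi)$ swept when the ray $XP$ is turned counterclockwise onto the
  ray $XN$.\<close>

definition directed_angle :: "complex \<Rightarrow> complex \<Rightarrow> complex \<Rightarrow> real" where
  "directed_angle P X N = Arg2pi ((N - X) / (P - X))"

text \<open>Shoelace formula; positive iff a simple quadrilateral is traversed counterclockwise.\<close>

definition signed_area :: "complex quad \<Rightarrow> real" where
  "signed_area Q =
     (Im (cnj (vA Q) * vB Q) + Im (cnj (vB Q) * vC Q) +
      Im (cnj (vC Q) * vD Q) + Im (cnj (vD Q) * vA Q)) / 2"

text \<open>For a simple quadrilateral, the interior angle at the vertex \<open>X\<close> with predecessor \<open>P\<close> and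
  successor \<open>N\<close>. It lies in $(0, 2\pi)$ and exceeds $\pi$ at a reflex vertex.\<close>

definition interior_angle :: "complex quad \<Rightarrow> complex \<Rightarrow> complex \<Rightarrow> complex \<Rightarrow> real" where
  "interior_angle Q P X N =
     (if signed_area Q > 0 then directed_angle N X P else directed_angle P X N)"

definition angle_A :: "complex quad \<Rightarrow> real" where
  "angle_A Q = interior_angle Q (vD Q) (vA Q) (vB Q)"

definition angle_B :: "complex quad \<Rightarrow> real" where
  "angle_B Q = interior_angle Q (vA Q) (vB Q) (vC Q)"

definition angle_C :: "complex quad \<Rightarrow> real" where
  "angle_C Q = interior_angle Q (vB Q) (vC Q) (vD Q)"

definition angle_D :: "complex quad \<Rightarrow> real" where
  "angle_D Q = interior_angle Q (vC Q) (vD Q) (vA Q)"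

text \<open>For a nondegenerate quadrilateral adjacent sides meet only in their common vertex, so only
  opposite sides have to be considered.\<close>

definition simple_quad :: "complex quad \<Rightarrow> bool" where
  "simple_quad Q \<longleftrightarrow>
     closed_segment (vA Q) (vB Q) \<inter> closed_segment (vC Q) (vD Q) = {} \<and>
     closed_segment (vB Q) (vC Q) \<inter> closed_segment (vD Q) (vA Q) = {}"

definition convex_quad :: "complex quad \<Rightarrow> bool" where
  "convex_quad Q \<longleftrightarrow> simple_quad Q \<and>
     angle_A Q < pi \<and> angle_B Q < pi \<and> angle_C Q < pi \<and> angle_D Q < pi"

definition concave_quad :: "complex quad \<Rightarrow> bool" where
  "concave_quad Q \<longleftrightarrow> simple_quad Q \<and>
     (angle_A Q > pi \<or> angle_B Q > pi \<or> angle_C Q > pi \<or> angle_D Q > pi)"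

text \<open>A similarity of the plane may reverse orientation.\<close>

definition plane_similarity :: "(complex \<Rightarrow> complex) \<Rightarrow> bool" where
  "plane_similarity f \<longleftrightarrow> (\<exists>k>0. \<forall>x y. dist (f x) (f y) = k * dist x y)"

definition similar_quad :: "complex quad \<Rightarrow> complex quad \<Rightarrow> bool" where
  "similar_quad Q Q' \<longleftrightarrow> (\<exists>f. plane_similarity f \<and> map_quad f Q = Q')"

definition homothety :: "complex \<Rightarrow> real \<Rightarrow> complex \<Rightarrow> complex" where
  "homothety W k X = W + of_real k * (X - W)"

definition rotation :: "complex \<Rightarrow> real \<Rightarrow> complex \<Rightarrow> complex" where
  "rotation W \<theta> X = W + cis \<theta> * (X - W)"

definition spiral_similarity :: "complex \<Rightarrow> real \<Rightarrow> real \<Rightarrow> complex \<Rightarrow> complex" where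
  "spiral_similarity W k \<theta> = homothety W k \<circ> rotation W \<theta>"

end

theory Submission
  imports Defs
begin

text \<open>Write \<open>Q = ABCD\<close> and \<open>Q'\<close> for the next generation \<open>A'B'C'D'\<close>. The
  circumcenters \<open>A'\<close> of \<open>DAB\<close> and \<open>B'\<close> of \<open>ABC\<close> both lie on the perpendicular bisector of \<open>AB\<close>, so
  \<open>B' - A' = \<i> s (B - A)\<close> with a real number \<open>s\<close> (\<open>side_ratio\<close>). A circumcenter sits at the
  height \<open>cot/2\<close> over a side of length 1, where the cotangent is that of the angle facing the side;
  hence \<open>s\<close> is half the difference of the cotangents of \<open>ACB\<close> and \<open>ADB\<close>, and this is
  \<open>\<Delta> / (2 [A] [B])\<close>. Here \<open>[X]\<close> is twice the signed area of the triangle formed by the vertex \<open>X\<close> and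
  its two neighbours, and \<open>\<Delta> = [A] [C] (cot A + cot C)\<close> (\<open>cyclic_defect\<close>) vanishes exactly
  when \<open>A + C\<close> is a multiple of \<open>\<pi>\<close>, that is, when \<open>Q\<close> is cyclic. Thus \<open>Q'\<close> shrinks to a
  point exactly for cyclic \<open>Q\<close>.

  Relabelling the vertices cyclically changes \<open>\<Delta>\<close> into \<open>-\<Delta>\<close>. So the four sides have the ratios
  \<open>s\<^sub>0, s\<^sub>1, s\<^sub>2, s\<^sub>3\<close> of alternating form \<open>\<plusminus>\<Delta> / (2 [X] [Y])\<close>, and
  \<open>s\<^sub>0 s\<^sub>2 = s\<^sub>1 s\<^sub>3 = \<Delta>\<^sup>2 / (4 [A] [B] [C] [D])\<close>. At a vertex of \<open>Q'\<close> the scalar and the cross product of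
  the two sides are those of \<open>Q\<close>, times the product of the two ratios. It follows that the cotangents
  of the angles are preserved up to orientation, which makes corresponding angles supplementary modulo
  \<open>\<pi>\<close>; for convex \<open>Q\<close> adjacent ratios have opposite signs, so the orientation is reversed, all
  angles stay below \<open>\<pi>\<close> and they are exactly supplementary. It also follows that the first side
  ratio of \<open>Q'\<close> is \<open>s\<^sub>2\<close>. Two steps therefore multiply every side by
  \<open>\<i> s\<^sub>2 \<i> s\<^sub>0 = - s\<^sub>0 s\<^sub>2 = r\<close>, a real number that is the same for all sides: two steps are \<open>X \<mapsto> r X + t\<close>. The cotangent form of \<open>\<Delta>\<close> turns \<open>r\<close> into
  a quarter of the product of the two sums of cotangents, and its sign is opposite to that of \<open>[A] [B] [C] [D]\<close>, which is positive for
  a convex quadrilateral and negative for a concave one.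

  If \<open>r \<noteq> 1\<close>, the map \<open>X \<mapsto> r X + t\<close> has a fixed point \<open>W\<close> and is a homothety. The delicate case is
  \<open>r = 1\<close>, where the map could be a translation. Since the angles of \<open>Q\<close> add up to a multiple of
  \<open>2\<pi>\<close>, their cotangents satisfy a cubic relation; together with \<open>r = 1\<close> it forces
  \<open>cot A = cot C\<close>, \<open>cot B = cot D\<close> and \<open>cot A cot B = 1\<close> (lemma \<open>extremal_cotangents\<close>). This makes
  \<open>ABCD\<close> an orthocentric system, whose four circumcircles are congruent, so that \<open>A\<close> is itself the
  circumcenter of \<open>D'A'B'\<close> and \<open>t = 0\<close>.

  Finally the construction commutes with homotheties, so the homothety that takes the first
  generation to the third takes every generation to the second next one. All
  similarities between generations of the same parity are its powers, and its center serves both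
  parities.\<close>

section \<open>Circumcenters and cotangents\<close>

definition cross :: "complex \<Rightarrow> complex \<Rightarrow> real" where
  "cross u v = Re u * Im v - Im u * Re v"

lemma collinear_iff_cross:
  fixes X Y Z :: complex
  shows "collinear {X, Y, Z} \<longleftrightarrow> cross (X - Y) (Z - Y) = 0"
proof -
  have "collinear {X, Y, Z} \<longleftrightarrow> (Z - Y) / (X - Y) \<in> \<real>"
    by (simp add: collinear_3 NO_MATCH_def collinear_iff_Reals)
  also have "\<dots> \<longleftrightarrow> cross (X - Y) (Z - Y) = 0"
  proof (cases "X = Y")
    case False
    then show ?thesis
      by (auto simp: complex_is_Real_iff Im_divide cross_def complex_eq_iff algebra_simps)
  qed (simp add: cross_def)
  finally show ?thesis .
qed

lemma dist_eq_iff_power2: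
  fixes P :: complex
  shows "dist P X = dist P Y \<longleftrightarrow>
    (Re P - Re X)\<^sup>2 + (Im P - Im X)\<^sup>2 = (Re P - Re Y)\<^sup>2 + (Im P - Im Y)\<^sup>2"
  by (simp add: dist_norm cmod_def)

text \<open>The difference of two points equidistant from \<open>X\<close>, \<open>Y\<close>, \<open>Z\<close> is orthogonal to the two
  independent vectors \<open>X - Z\<close> and \<open>Y - Z\<close>.\<close>

lemma circumcenter_eqI:
  assumes "cross (X - Z) (Y - Z) \<noteq> 0" "dist P X = dist P Y" "dist P Y = dist P Z"
  shows "circumcenter X Y Z = P"
  unfolding circumcenter_def
proof (rule the_equality)
  fix P' assume "dist P' X = dist P' Y \<and> dist P' Y = dist P' Z"
  then have eqs: "dist P' X = dist P' Y" "dist P' Y = dist P' Z" by auto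
  define p q where "p = Re (P' - P)" and "q = Im (P' - P)"
  have 1: "p * Re (X - Z) + q * Im (X - Z) = 0" and 2: "p * Re (Y - Z) + q * Im (Y - Z) = 0"
    using eqs assms(2,3) unfolding dist_eq_iff_power2 p_def q_def minus_complex.sel by algebra+
  have "p * cross (X - Z) (Y - Z) = 0" "q * cross (X - Z) (Y - Z) = 0"
    using 1 2 unfolding cross_def by algebra+
  with assms(1) show "P' = P"
    by (simp add: p_def q_def complex_eq_iff)
qed (use assms in auto)

text \<open>The cotangent of the directed angle at \<open>Z\<close> from \<open>X\<close> to \<open>Y\<close>.\<close>

definition cot_at :: "complex \<Rightarrow> complex \<Rightarrow> complex \<Rightarrow> real" where
  "cot_at Z X Y = (X - Z) \<bullet> (Y - Z) / cross (X - Z) (Y - Z)"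

text \<open>The points of the perpendicular bisector of \<open>XY\<close>, parametrised so that for the circumcenter of
  a triangle the parameter is the cotangent of its angle facing \<open>XY\<close>.\<close>

definition bisector_point :: "complex \<Rightarrow> complex \<Rightarrow> real \<Rightarrow> complex" where
  "bisector_point X Y c = (X + Y) / 2 + \<i> * of_real (c / 2) * (Y - X)"

lemma dist_bisector_point:
  "(dist (bisector_point X Y c) X)\<^sup>2 = (1 + c\<^sup>2) / 4 * (dist X Y)\<^sup>2"
  "(dist (bisector_point X Y c) Y)\<^sup>2 = (1 + c\<^sup>2) / 4 * (dist X Y)\<^sup>2"
  unfolding dist_norm cmod_power2 bisector_point_def
  by (simp_all add: field_simps power2_eq_square)

lemma bisector_point_move:
  "bisector_point X Y c + \<i> * of_real s * (Y - X) = bisector_point X Y (c + 2 * s)"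
  by (simp add: bisector_point_def add_divide_distrib algebra_simps)

text \<open>By the central angle theorem the side \<open>XY\<close> is seen from the circumcenter under twice the angle at
  \<open>Z\<close>, which places the circumcenter at the signed height \<open>cot Z / 2\<close>, relative to the length of \<open>XY\<close>,
  over the midpoint.\<close>

lemma bisector_point_equidistant:
  assumes "cross (X - Z) (Y - Z) \<noteq> 0"
  defines "P \<equiv> bisector_point X Y (cot_at Z X Y)"
  shows "dist P X = dist P Y" and "dist P Y = dist P Z"
proof -
  define k where "k = cross (X - Z) (Y - Z)"
  have k: "k \<noteq> 0" using assms by (simp add: k_def)
  have c: "cot_at Z X Y * k = (X - Z) \<bullet> (Y - Z)"
    using k by (simp add: cot_at_def k_def)
  show "dist P X = dist P Y"
    by (rule power2_eq_imp_eq) (simp_all add: P_def dist_bisector_point)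
  have re: "2 * Re P = Re X + Re Y - cot_at Z X Y * Im (Y - X)"
    and im: "2 * Im P = Im X + Im Y + cot_at Z X Y * Re (Y - X)"
    by (simp_all add: P_def bisector_point_def algebra_simps add_divide_distrib diff_divide_distrib)
  have "2 * k * ((Re P - Re Y)\<^sup>2 + (Im P - Im Y)\<^sup>2 - (Re P - Re Z)\<^sup>2 - (Im P - Im Z)\<^sup>2) = 0"
    using re im c unfolding k_def cross_def inner_complex_def minus_complex.sel by algebra
  then show "dist P Y = dist P Z"
    using k by (simp add: dist_eq_iff_power2)
qed

lemma circumcenter_eq_bisector_point:
  assumes "cross (X - Z) (Y - Z) \<noteq> 0"
  shows "circumcenter X Y Z = bisector_point X Y (cot_at Z X Y)"
    and "circumcenter Z X Y = bisector_point X Y (cot_at Z X Y)"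
proof -
  note eq = bisector_point_equidistant[OF assms]
  show "circumcenter X Y Z = bisector_point X Y (cot_at Z X Y)"
    using assms eq by (rule circumcenter_eqI)
  have "cross (Z - Y) (X - Y) \<noteq> 0"
    using assms by (simp add: cross_def algebra_simps)
  then show "circumcenter Z X Y = bisector_point X Y (cot_at Z X Y)"
    using eq by (intro circumcenter_eqI) auto
qed

lemma circumcenter_equidistant:
  assumes "cross (X - Z) (Y - Z) \<noteq> 0"
  shows "dist (circumcenter X Y Z) X = dist (circumcenter X Y Z) Y"
    and "dist (circumcenter X Y Z) Y = dist (circumcenter X Y Z) Z"
  using bisector_point_equidistant[OF assms] circumcenter_eq_bisector_point[OF assms] by auto

section \<open>Vertex invariants and the cyclic symmetry of the construction\<close>

text \<open>The construction commutes with the cyclic relabelling of the vertices. Everything is therefore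
  stated for the vertex \<open>A\<close> or the side \<open>AB\<close> only, and transferred to the others by shifting.\<close>

definition shift_quad :: "'a quad \<Rightarrow> 'a quad" where
  "shift_quad Q = Quad (vB Q) (vC Q) (vD Q) (vA Q)"

lemma shift_quad_sel [simp]:
  "vA (shift_quad Q) = vB Q" "vB (shift_quad Q) = vC Q"
  "vC (shift_quad Q) = vD Q" "vD (shift_quad Q) = vA Q"
  by (simp_all add: shift_quad_def)

lemma shift_quad_4 [simp]: "shift_quad (shift_quad (shift_quad (shift_quad Q))) = Q"
  by (simp add: shift_quad_def)

lemma pb_step_shift: "pb_step (shift_quad Q) = shift_quad (pb_step Q)"
  by (simp add: pb_step_def shift_quad_def)

text \<open>Twice the signed area of the triangle \<open>DAB\<close>.\<close>

definition vcross :: "complex quad \<Rightarrow> real" where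
  "vcross Q = cross (vB Q - vA Q) (vD Q - vA Q)"

definition vdot :: "complex quad \<Rightarrow> real" where
  "vdot Q = (vB Q - vA Q) \<bullet> (vD Q - vA Q)"

lemma nondegenerate_iff_vcross:
  "nondegenerate Q \<longleftrightarrow> vcross Q \<noteq> 0 \<and> vcross (shift_quad Q) \<noteq> 0 \<and>
     vcross (shift_quad (shift_quad Q)) \<noteq> 0 \<and>
     vcross (shift_quad (shift_quad (shift_quad Q))) \<noteq> 0"
proof -
  have anti: "cross u v = 0 \<longleftrightarrow> cross v u = 0" for u v
    by (auto simp: cross_def algebra_simps)
  show ?thesis
    unfolding nondegenerate_def collinear_iff_cross vcross_def shift_quad_sel
    by (metis anti)
qed

lemma nondegenerate_shift [simp]: "nondegenerate (shift_quad Q) \<longleftrightarrow> nondegenerate Q"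
  by (auto simp: nondegenerate_iff_vcross)

text \<open>This is the cleared form of \<open>cot A + cot C\<close>, up to sign the in-circle determinant of the four
  vertices. As a polynomial in the coordinates it also makes sense, and is antisymmetric under
  shifting, for degenerate quadrilaterals.\<close>

definition cyclic_defect :: "complex quad \<Rightarrow> real" where
  "cyclic_defect Q =
     vdot Q * vcross (shift_quad (shift_quad Q)) + vdot (shift_quad (shift_quad Q)) * vcross Q"

lemma cyclic_defect_shift: "cyclic_defect (shift_quad Q) = - cyclic_defect Q"
  unfolding cyclic_defect_def vdot_def vcross_def cross_def inner_complex_def shift_quad_sel
    minus_complex.sel
  by algebra

text \<open>The factor, apart from the right angle, by which the construction multiplies the side \<open>AB\<close>.\<close>

definition side_ratio :: "complex quad \<Rightarrow> real" where
  "side_ratio Q = cyclic_defect Q / (2 * vcross Q * vcross (shift_quad Q))"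

text \<open>The signed ratio of two consecutive steps; the minus sign is the square of the right angle turn.\<close>

definition step_ratio :: "complex quad \<Rightarrow> real" where
  "step_ratio Q = - (side_ratio Q * side_ratio (shift_quad (shift_quad Q)))"

section \<open>Sides and angles of the next generation\<close>

text \<open>Both ends of the new side lie on the perpendicular bisector of \<open>AB\<close>, with parameters the
  cotangents of the angles \<open>ACB\<close> and \<open>ADB\<close>; the numerator of their difference is the defect.\<close>

lemma pb_step_side_AB:
  assumes "nondegenerate Q"
  shows "vB (pb_step Q) - vA (pb_step Q) = \<i> * of_real (side_ratio Q) * (vB Q - vA Q)"
proof -
  define A B C D where "A = vA Q" and "B = vB Q" and "C = vC Q" and "D = vD Q"
  note ABCD = A_def B_def C_def D_def
  define k l where "k = vcross Q" and "l = vcross (shift_quad Q)"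
  have nz: "k \<noteq> 0" "l \<noteq> 0"
    using assms by (auto simp: nondegenerate_iff_vcross k_def l_def)
  have kl: "cross (A - D) (B - D) = k" "cross (A - C) (B - C) = l"
    unfolding k_def l_def vcross_def shift_quad_sel ABCD cross_def minus_complex.sel by algebra+
  have b: "vB (pb_step Q) = bisector_point A B (cot_at C A B)"
    and a: "vA (pb_step Q) = bisector_point A B (cot_at D A B)"
    using circumcenter_eq_bisector_point[of A C B] circumcenter_eq_bisector_point[of A D B] kl nz
    by (simp_all add: pb_step_def ABCD)
  have "cyclic_defect Q = (A - C) \<bullet> (B - C) * k - (A - D) \<bullet> (B - D) * l"
    unfolding cyclic_defect_def vdot_def vcross_def cross_def inner_complex_def shift_quad_sel
      minus_complex.sel ABCD k_def l_def
    by algebra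
  then have ratio: "side_ratio Q = (cot_at C A B - cot_at D A B) / 2"
    using nz unfolding side_ratio_def k_def[symmetric] l_def[symmetric] cot_at_def kl
    by (simp add: field_simps)
  show ?thesis
    unfolding ratio a b bisector_point_def A_def[symmetric] B_def[symmetric]
    by (simp add: algebra_simps add_divide_distrib diff_divide_distrib)
qed

text \<open>The side \<open>DA\<close> is the side \<open>AB\<close> of the quadrilateral shifted three times. Together with the
  previous lemma this describes the new angle at \<open>A\<close>.\<close>

lemma pb_step_side_AD:
  assumes "nondegenerate Q"
  shows "vD (pb_step Q) - vA (pb_step Q) =
    \<i> * of_real (side_ratio (shift_quad (shift_quad (shift_quad Q)))) * (vD Q - vA Q)"
  using pb_step_side_AB[of "shift_quad (shift_quad (shift_quad Q))"] assms
  by (simp add: pb_step_shift algebra_simps)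

lemma cross_turned: "cross (\<i> * of_real s * u) (\<i> * of_real t * v) = s * t * cross u v"
  and inner_turned: "(\<i> * of_real s * u) \<bullet> (\<i> * of_real t * v) = s * t * (u \<bullet> v)"
  by (simp_all add: cross_def inner_complex_def algebra_simps)

lemma vcross_pb_step:
  assumes "nondegenerate Q"
  shows "vcross (pb_step Q) =
    side_ratio Q * side_ratio (shift_quad (shift_quad (shift_quad Q))) * vcross Q"
  unfolding vcross_def pb_step_side_AB[OF assms] pb_step_side_AD[OF assms] cross_turned ..

lemma vdot_pb_step:
  assumes "nondegenerate Q"
  shows "vdot (pb_step Q) =
    side_ratio Q * side_ratio (shift_quad (shift_quad (shift_quad Q))) * vdot Q"
  unfolding vdot_def pb_step_side_AB[OF assms] pb_step_side_AD[OF assms] inner_turned ..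

text \<open>Either diagonal cuts the quadrilateral into two triangles with the same total signed area.\<close>

lemma vcross_alternating_sums:
  "vcross Q + vcross (shift_quad (shift_quad Q)) =
   vcross (shift_quad Q) + vcross (shift_quad (shift_quad (shift_quad Q)))"
  unfolding vcross_def cross_def shift_quad_sel minus_complex.sel by algebra

section \<open>Cyclic quadrilaterals\<close>

lemma pb_step_point_if_no_defect:
  assumes "nondegenerate Q" "cyclic_defect Q = 0"
  shows "\<exists>P. pb_step Q = Quad P P P P"
proof -
  have "vB (pb_step R) = vA (pb_step R)" if "nondegenerate R" "cyclic_defect R = 0" for R
    using pb_step_side_AB[OF that(1)] that(2) by (simp add: side_ratio_def)
  from this[of Q] this[of "shift_quad Q"] this[of "shift_quad (shift_quad Q)"] assms
  have "vB (pb_step Q) = vA (pb_step Q)" "vC (pb_step Q) = vA (pb_step Q)"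
    "vD (pb_step Q) = vA (pb_step Q)"
    by (simp_all add: cyclic_defect_shift pb_step_shift)
  then have "pb_step Q = Quad (vA (pb_step Q)) (vA (pb_step Q)) (vA (pb_step Q)) (vA (pb_step Q))"
    by (intro quad.expand) simp
  then show ?thesis ..
qed

lemma cyclic_if_pb_step_point:
  assumes "nondegenerate Q" "pb_step Q = Quad P P P P"
  shows "cyclic Q"
proof -
  have P: "circumcenter (vD Q) (vA Q) (vB Q) = P" "circumcenter (vA Q) (vB Q) (vC Q) = P"
    using assms(2) by (simp_all add: pb_step_def)
  have "cross (vD Q - vB Q) (vA Q - vB Q) \<noteq> 0" "cross (vA Q - vC Q) (vB Q - vC Q) \<noteq> 0"
    using assms(1) by (auto simp: nondegenerate_iff_vcross vcross_def cross_def algebra_simps)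
  from this[THEN circumcenter_equidistant(1)] this[THEN circumcenter_equidistant(2)]
  have "dist P (vD Q) = dist P (vA Q)" "dist P (vB Q) = dist P (vA Q)"
    "dist P (vC Q) = dist P (vA Q)"
    unfolding P by auto
  then have "\<forall>X \<in> set_quad Q. dist P X = dist P (vA Q)"
    by (cases Q) auto
  then show ?thesis
    unfolding cyclic_def by blast
qed

lemma pb_step_point_if_cyclic:
  assumes "nondegenerate Q" "cyclic Q"
  shows "\<exists>P. pb_step Q = Quad P P P P"
proof -
  obtain M R where "\<forall>X \<in> set_quad Q. dist M X = R"
    using assms(2) by (auto simp: cyclic_def)
  then have M: "dist M (vA Q) = R" "dist M (vB Q) = R" "dist M (vC Q) = R" "dist M (vD Q) = R"
    by (cases Q; simp)+
  have nz: "cross (vD Q - vB Q) (vA Q - vB Q) \<noteq> 0" "cross (vA Q - vC Q) (vB Q - vC Q) \<noteq> 0"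
    "cross (vB Q - vD Q) (vC Q - vD Q) \<noteq> 0" "cross (vC Q - vA Q) (vD Q - vA Q) \<noteq> 0"
    using assms(1) by (auto simp: nondegenerate_iff_vcross vcross_def cross_def algebra_simps)
  have "pb_step Q = Quad M M M M"
    unfolding pb_step_def using M
    by (simp add: circumcenter_eqI[OF nz(1)] circumcenter_eqI[OF nz(2)]
        circumcenter_eqI[OF nz(3)] circumcenter_eqI[OF nz(4)])
  then show ?thesis by blast
qed

lemma side_nonzero:
  assumes "nondegenerate Q" shows "vB Q \<noteq> vA Q"
  using assms by (auto simp: nondegenerate_iff_vcross vcross_def cross_def)

lemma cyclic_iff_no_defect:
  assumes "nondegenerate Q"
  shows "cyclic Q \<longleftrightarrow> cyclic_defect Q = 0"
proof
  assume "cyclic Q"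
  then obtain P where "pb_step Q = Quad P P P P"
    using pb_step_point_if_cyclic[OF assms] by blast
  then have "side_ratio Q = 0"
    using pb_step_side_AB[OF assms] side_nonzero[OF assms] by simp
  then show "cyclic_defect Q = 0"
    using assms by (auto simp: side_ratio_def nondegenerate_iff_vcross)
qed (use assms pb_step_point_if_no_defect cyclic_if_pb_step_point in blast)

lemma cyclic_shift: "nondegenerate Q \<Longrightarrow> cyclic (shift_quad Q) \<longleftrightarrow> cyclic Q"
  by (simp add: cyclic_iff_no_defect cyclic_defect_shift)

lemma side_ratio_nonzero:
  assumes "nondegenerate Q" "\<not> cyclic Q"
  shows "side_ratio Q \<noteq> 0"
  using assms by (auto simp: side_ratio_def cyclic_iff_no_defect nondegenerate_iff_vcross)

text \<open>The signed area of each triangle of consecutive vertices is multiplied by two side ratios, none of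
  which is zero.\<close>

lemma nondegenerate_pb_step:
  assumes "nondegenerate Q" "\<not> cyclic Q"
  shows "nondegenerate (pb_step Q)"
proof -
  have "vcross (pb_step R) \<noteq> 0" if "nondegenerate R" "\<not> cyclic R" for R
    using that side_ratio_nonzero[of R] side_ratio_nonzero[of "shift_quad (shift_quad (shift_quad R))"]
    by (auto simp: vcross_pb_step cyclic_shift) (auto simp: nondegenerate_iff_vcross)
  from this[of Q] this[of "shift_quad Q"] this[of "shift_quad (shift_quad Q)"]
    this[of "shift_quad (shift_quad (shift_quad Q))"] assms
  show ?thesis
    by (simp add: nondegenerate_iff_vcross[of "pb_step Q"] pb_step_shift cyclic_shift)
qed

section \<open>Two consecutive steps\<close>

lemma step_ratio_shift: "step_ratio (shift_quad Q) = step_ratio Q"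
  by (simp add: step_ratio_def side_ratio_def cyclic_defect_shift)

lemma cyclic_defect_pb_step:
  assumes "nondegenerate Q"
  shows "cyclic_defect (pb_step Q) =
    side_ratio Q * side_ratio (shift_quad Q) * side_ratio (shift_quad (shift_quad Q)) *
    side_ratio (shift_quad (shift_quad (shift_quad Q))) * cyclic_defect Q"
  using assms
  by (simp add: cyclic_defect_def vcross_pb_step vdot_pb_step algebra_simps flip: pb_step_shift)

text \<open>In the ratio for the new quadrilateral, the defect has gained the factor \<open>s\<^sub>0 s\<^sub>1 s\<^sub>2 s\<^sub>3\<close> and the two
  areas have gained \<open>s\<^sub>0 s\<^sub>3\<close> and \<open>s\<^sub>1 s\<^sub>0\<close>, so the old ratio \<open>s\<^sub>0\<close> is multiplied by \<open>s\<^sub>2 / s\<^sub>0\<close>.\<close>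

lemma side_ratio_pb_step:
  assumes "nondegenerate Q" "\<not> cyclic Q"
  shows "side_ratio (pb_step Q) = side_ratio (shift_quad (shift_quad Q))"
proof -
  define s0 s1 s2 s3 where s: "s0 = side_ratio Q" "s1 = side_ratio (shift_quad Q)"
    "s2 = side_ratio (shift_quad (shift_quad Q))"
    "s3 = side_ratio (shift_quad (shift_quad (shift_quad Q)))"
  have nz: "s0 \<noteq> 0" "s1 \<noteq> 0" "s2 \<noteq> 0" "s3 \<noteq> 0"
    unfolding s using assms by (simp_all add: side_ratio_nonzero cyclic_shift)
  have k: "vcross Q \<noteq> 0" "vcross (shift_quad Q) \<noteq> 0"
    using assms by (auto simp: nondegenerate_iff_vcross)
  have "side_ratio (pb_step Q) = s0 * s1 * s2 * s3 * cyclic_defect Q /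
      (2 * (s0 * s3 * vcross Q) * (s1 * s0 * vcross (shift_quad Q)))"
    using assms unfolding side_ratio_def[of "pb_step Q"]
    by (simp add: cyclic_defect_pb_step vcross_pb_step s flip: pb_step_shift)
  also have "\<dots> = s2 / s0 * (cyclic_defect Q / (2 * vcross Q * vcross (shift_quad Q)))"
    using nz k by (simp add: field_simps)
  also have "\<dots> = s2"
    using nz unfolding side_ratio_def[symmetric] s(1)[symmetric] by simp
  finally show ?thesis by (simp add: s)
qed

lemma two_steps_side_AB:
  assumes "nondegenerate Q" "\<not> cyclic Q"
  shows "vB (pb_step (pb_step Q)) - vA (pb_step (pb_step Q)) =
    of_real (step_ratio Q) * (vB Q - vA Q)"
  using assms
  by (simp add: pb_step_side_AB nondegenerate_pb_step side_ratio_pb_step step_ratio_def algebra_simps)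

text \<open>All four sides are multiplied by the same real number, so a single vertex determines the position
  of the quadrilateral.\<close>

lemma two_steps_translate:
  assumes "nondegenerate Q" "\<not> cyclic Q"
  defines "t \<equiv> vA (pb_step (pb_step Q)) - of_real (step_ratio Q) * vA Q"
  shows "pb_step (pb_step Q) = map_quad (\<lambda>X. of_real (step_ratio Q) * X + t) Q"
proof -
  let ?r = "of_real (step_ratio Q) :: complex" and ?T = "pb_step (pb_step Q)"
  have "vB (pb_step (pb_step R)) - vA (pb_step (pb_step R)) = ?r * (vB R - vA R)"
    if "R \<in> {Q, shift_quad Q, shift_quad (shift_quad Q)}" for R
    using that assms two_steps_side_AB[of R] by (auto simp: step_ratio_shift cyclic_shift)
  from this[of Q] this[of "shift_quad Q"] this[of "shift_quad (shift_quad Q)"]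
  have sides: "vB ?T - vA ?T = ?r * (vB Q - vA Q)" "vC ?T - vB ?T = ?r * (vC Q - vB Q)"
    "vD ?T - vC ?T = ?r * (vD Q - vC Q)"
    by (simp_all add: pb_step_shift)
  have "vA ?T = ?r * vA Q + t"
    by (simp add: t_def)
  moreover from this sides(1) have "vB ?T = ?r * vB Q + t" by algebra
  moreover from this sides(2) have "vC ?T = ?r * vC Q + t" by algebra
  moreover from this sides(3) have "vD ?T = ?r * vD Q + t" by algebra
  ultimately show ?thesis
    by (intro quad.expand) (simp add: quad.map_sel)
qed

section \<open>Cotangents of the angles\<close>

definition vcot :: "complex quad \<Rightarrow> real" where
  "vcot Q = vdot Q / vcross Q"

text \<open>The cotangent form of the fact that the four angles add up to a multiple of \<open>2\<pi>\<close>: every side enters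
  the product of the four quotients of adjacent sides once as a numerator and once as a
  denominator, so the product of the numbers \<open>cot + \<i>\<close> is real.\<close>

lemma vcot_sum_eq_triple_products:
  assumes "nondegenerate Q"
  defines "a \<equiv> vcot Q" and "b \<equiv> vcot (shift_quad Q)" and "c \<equiv> vcot (shift_quad (shift_quad Q))"
    and "d \<equiv> vcot (shift_quad (shift_quad (shift_quad Q)))"
  shows "a + b + c + d = a * b * c + a * b * d + a * c * d + b * c * d"
proof -
  define u where "u R = vB R - vA R" for R :: "complex quad"
  define q where "q R = Complex (vcot R) 1" for R
  let ?Q1 = "shift_quad Q" and ?Q2 = "shift_quad (shift_quad Q)"
    and ?Q3 = "shift_quad (shift_quad (shift_quad Q))"
  have q: "q R = of_real (- 1 / vcross R) * (cnj (u R) * u (shift_quad (shift_quad (shift_quad R))))"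
    if "vcross R \<noteq> 0" for R
    using that by (simp add: complex_eq_iff q_def vcot_def vdot_def vcross_def u_def cross_def
        inner_complex_def field_simps)
  have nz: "vcross Q \<noteq> 0" "vcross ?Q1 \<noteq> 0" "vcross ?Q2 \<noteq> 0" "vcross ?Q3 \<noteq> 0"
    using assms(1) by (auto simp: nondegenerate_iff_vcross)
  define x where "x = (- 1 / vcross Q) * (- 1 / vcross ?Q1) * (- 1 / vcross ?Q2) * (- 1 / vcross ?Q3)"
  \<comment> \<open>the side \<open>DA\<close> of a quadrilateral is the side \<open>AB\<close> of its third shift, so each side meets its own conjugate\<close>
  have "q Q * q ?Q1 * q ?Q2 * q ?Q3 =
      of_real x * ((u Q * cnj (u Q)) * (u ?Q1 * cnj (u ?Q1)) * (u ?Q2 * cnj (u ?Q2)) *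
        (u ?Q3 * cnj (u ?Q3)))"
    unfolding x_def of_real_mult q[OF nz(1)] q[OF nz(2)] q[OF nz(3)] q[OF nz(4)] shift_quad_4
    by (simp only: mult_ac)
  then have "Im (q Q * q ?Q1 * q ?Q2 * q ?Q3) = 0"
    by (simp only: complex_norm_square[symmetric] of_real_mult[symmetric] Im_complex_of_real
        of_real_power[symmetric])
  then show ?thesis
    unfolding a_def b_def c_def d_def q_def by (simp add: algebra_simps)
qed

lemma step_ratio_eq_vcot:
  assumes "nondegenerate Q"
  shows "step_ratio Q = 1 / 4 * (vcot Q + vcot (shift_quad (shift_quad Q))) *
    (vcot (shift_quad Q) + vcot (shift_quad (shift_quad (shift_quad Q))))"
proof -
  have sum: "vcot R + vcot (shift_quad (shift_quad R)) =
      cyclic_defect R / (vcross R * vcross (shift_quad (shift_quad R)))" if "nondegenerate R" for R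
    using that by (simp add: vcot_def cyclic_defect_def nondegenerate_iff_vcross field_simps)
  show ?thesis
    using assms sum[of Q] sum[of "shift_quad Q"]
    by (simp add: step_ratio_def side_ratio_def cyclic_defect_shift)
qed

text \<open>With \<open>p = a + c\<close> and \<open>q = b + d\<close>, the first equation reads \<open>p + q = a c q + b d p\<close>. By the inequality
  of the means \<open>a c \<le> p\<^sup>2 / 4\<close> and \<open>b d \<le> q\<^sup>2 / 4\<close>, so for \<open>p q = 4\<close> with \<open>p, q > 0\<close> the right-hand side is
  at most \<open>p q (p + q) / 4 = p + q\<close>. Equality in both means is thus forced; the case \<open>p, q < 0\<close> is
  symmetric, and the sum of squares below treats both at once.\<close>

lemma extremal_cotangents:
  fixes a b c d :: real
  assumes "a + b + c + d = a * b * c + a * b * d + a * c * d + b * c * d"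
    and "(a + c) * (b + d) = 4"
  shows "c = a" "d = b" "a * b = 1"
proof -
  \<comment> \<open>the defect \<open>(a - c)\<^sup>2 q + (b - d)\<^sup>2 p\<close> of the two means vanishes; multiply it by \<open>q\<close>\<close>
  have "((a - c) * (b + d))\<^sup>2 + (2 * (b - d))\<^sup>2 = 0"
    using assms by algebra
  then have "(a - c) * (b + d) = 0 \<and> 2 * (b - d) = 0"
    by (simp only: sum_power2_eq_zero_iff)
  moreover have "b + d \<noteq> 0" using assms(2) by auto
  ultimately show "c = a" "d = b" by auto
  then show "a * b = 1" using assms(2) by simp
qed

section \<open>The case of ratio one\<close>

text \<open>The angle conditions determine \<open>C\<close> from \<open>A\<close>, \<open>B\<close>, \<open>D\<close>: expanding \<open>C - A\<close> in the basis \<open>u = B - A\<close>,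
  \<open>v = D - A\<close> gives the coordinates \<open>k3 / k0\<close> and \<open>k1 / k0\<close>, and the conditions become linear equations
  for them with coefficients \<open>M = u \<bullet> u\<close> and \<open>N = v \<bullet> v\<close>. The outcome says that the angles \<open>ACB\<close> and
  \<open>ADB\<close> have opposite cotangents, and likewise \<open>DCA\<close> and \<open>DBA\<close>.\<close>

lemma orthocentric_side_ratios:
  assumes "nondegenerate Q" "step_ratio Q = 1"
  shows "side_ratio Q = - cot_at (vD Q) (vA Q) (vB Q)"
    and "side_ratio (shift_quad (shift_quad (shift_quad Q))) = cot_at (vB Q) (vD Q) (vA Q)"
proof -
  let ?Q1 = "shift_quad Q" and ?Q2 = "shift_quad (shift_quad Q)"
    and ?Q3 = "shift_quad (shift_quad (shift_quad Q))"
  define k0 k1 k2 k3 where k: "k0 = vcross Q" "k1 = vcross ?Q1" "k2 = vcross ?Q2" "k3 = vcross ?Q3"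
  define a b where "a = vcot Q" and "b = vcot ?Q1"
  have nz: "k0 \<noteq> 0" "k1 \<noteq> 0" "k2 \<noteq> 0" "k3 \<noteq> 0"
    using assms(1) by (auto simp: nondegenerate_iff_vcross k)
  have cots: "vcot ?Q2 = a" "vcot ?Q3 = b" and ab: "a * b = 1"
    using extremal_cotangents[OF vcot_sum_eq_triple_products[OF assms(1)]] assms(2)
      step_ratio_eq_vcot[OF assms(1)]
    by (simp_all add: a_def b_def)
  have dots: "vdot Q = a * k0" "vdot ?Q1 = b * k1" "vdot ?Q2 = a * k2" "vdot ?Q3 = b * k3"
    using nz cots by (simp_all add: vcot_def a_def b_def k field_simps)
  define u v where "u = vB Q - vA Q" and "v = vD Q - vA Q"
  define M N where "M = u \<bullet> u" and "N = v \<bullet> v"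
  have sum: "k0 + k2 = k1 + k3"
    unfolding k by (rule vcross_alternating_sums)
  have 1: "(k0 - k3) * M = k0 * k1 * (a + b)"
  proof -
    have "k0 * vdot ?Q1 = (k0 - k3) * M - k1 * vdot Q"
      unfolding k M_def u_def vdot_def vcross_def cross_def inner_complex_def shift_quad_sel
        minus_complex.sel by algebra
    then show ?thesis unfolding dots by algebra
  qed
  have 2: "(k0 - k1) * N = k0 * k3 * (a + b)"
  proof -
    have "k0 * vdot ?Q3 = (k0 - k1) * N - k3 * vdot Q"
      unfolding k N_def v_def vdot_def vcross_def cross_def inner_complex_def shift_quad_sel
        minus_complex.sel by algebra
    then show ?thesis unfolding dots by algebra
  qed
  have "M * N = (vdot Q)\<^sup>2 + k0\<^sup>2"
    unfolding k M_def N_def u_def v_def vdot_def vcross_def cross_def inner_complex_def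
        minus_complex.sel by algebra
  then have MN: "M * N = k0\<^sup>2 * (1 + a\<^sup>2)"
    unfolding dots by algebra
  have ab': "a * (a + b) = 1 + a\<^sup>2"
    using ab by algebra
  have pos: "1 + a\<^sup>2 \<noteq> 0"
    by (rule not_sym, rule less_imp_neq) (simp add: add_pos_nonneg)
  have "k0 * (1 + a\<^sup>2) * (a * (k0 - k3) * k0) = a * (k0 - k3) * (M * N)"
    unfolding MN by algebra
  also have "\<dots> = k0 * (1 + a\<^sup>2) * (k1 * N)"
    unfolding ab'[symmetric] using 1 by algebra
  finally have 3: "a * (k0 - k3) * k0 = k1 * N"
    using pos nz by simp
  have "k0 * (1 + a\<^sup>2) * (a * (k0 - k1) * k0) = a * (k0 - k1) * (M * N)"
    unfolding MN by algebra
  also have "\<dots> = k0 * (1 + a\<^sup>2) * (k3 * M)"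
    unfolding ab'[symmetric] using 2 by algebra
  finally have 4: "a * (k0 - k1) * k0 = k3 * M"
    using pos nz by simp
  have "k0 * N = k0 * (a * k0 + k3 * b)"
    using 2 3 by algebra
  then have N: "N = a * k0 + k3 * b" using nz by simp
  have "k0 * M = k0 * (a * k0 + k1 * b)"
    using 1 4 by algebra
  then have M: "M = a * k0 + k1 * b" using nz by simp
  have k2: "k2 = k1 + k3 - k0" using sum by simp
  have key: "a * k2 * k0 = - (b * k1 * k3)"
    using 3 unfolding N k2 by algebra
  have d: "cyclic_defect Q = 2 * a * k0 * k2"
    by (simp add: cyclic_defect_def dots flip: k)
  have "side_ratio Q = a * k2 / k1"
    using nz by (simp add: side_ratio_def d flip: k)
  also have "\<dots> = - (b * k3 / k0)"
    using nz key by (simp add: field_simps)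
  also have "b * k3 / k0 = (N - vdot Q) / k0"
    by (simp add: N dots)
  also have "\<dots> = cot_at (vD Q) (vA Q) (vB Q)"
    unfolding cot_at_def k N_def v_def vdot_def vcross_def cross_def inner_complex_def
    by (simp add: algebra_simps)
  finally show "side_ratio Q = - cot_at (vD Q) (vA Q) (vB Q)" .
  have "side_ratio ?Q3 = - (a * k2 / k3)"
    using nz by (simp add: side_ratio_def d cyclic_defect_shift flip: k)
  also have "\<dots> = b * k1 / k0"
    using nz key by (simp add: field_simps)
  also have "\<dots> = (M - vdot Q) / k0"
    by (simp add: M dots)
  also have "\<dots> = cot_at (vB Q) (vD Q) (vA Q)"
    unfolding cot_at_def k M_def u_def vdot_def vcross_def cross_def inner_complex_def
    by (simp add: algebra_simps)
  finally show "side_ratio ?Q3 = cot_at (vB Q) (vD Q) (vA Q)" .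
qed

text \<open>Opposite cotangents over a common side mean that the circumcircles of \<open>DAB\<close>, \<open>ABC\<close> and \<open>CDA\<close> are
  congruent. As all three pass through \<open>A\<close>, their centers are equidistant from \<open>A\<close>.\<close>

lemma two_steps_fix_vertex:
  assumes "nondegenerate Q" "\<not> cyclic Q" "step_ratio Q = 1"
  shows "vA (pb_step (pb_step Q)) = vA Q"
proof -
  define A B D where "A = vA Q" and "B = vB Q" and "D = vD Q"
  define A' B' D' where "A' = vA (pb_step Q)" and "B' = vB (pb_step Q)" and "D' = vD (pb_step Q)"
  note defs = A_def B_def D_def A'_def B'_def D'_def
  have "cross (A - D) (B - D) \<noteq> 0" "cross (D - B) (A - B) \<noteq> 0"
    using assms(1) by (auto simp: nondegenerate_iff_vcross vcross_def cross_def defs algebra_simps)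
  from circumcenter_eq_bisector_point(2)[OF this(1)] circumcenter_eq_bisector_point(1)[OF this(2)]
  have A': "A' = bisector_point A B (cot_at D A B)" "A' = bisector_point D A (cot_at B D A)"
    by (simp_all add: defs pb_step_def)
  have "B' = A' + \<i> * of_real (- cot_at D A B) * (B - A)"
    using pb_step_side_AB[OF assms(1)] orthocentric_side_ratios(1)[OF assms(1,3)]
    unfolding defs by (metis add.commute diff_add_cancel)
  then have "B' = bisector_point A B (- cot_at D A B)"
    unfolding A'(1) bisector_point_move by simp
  then have "(dist B' A)\<^sup>2 = (dist A' A)\<^sup>2"
    unfolding A'(1) by (simp add: dist_bisector_point)
  then have 1: "dist A A' = dist A B'"
    by (simp add: dist_commute)
  have "D' - A' = \<i> * of_real (cot_at B D A) * (D - A)"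
    using pb_step_side_AD[OF assms(1)] orthocentric_side_ratios(2)[OF assms(1,3)]
    unfolding defs by simp
  then have "D' = A' + \<i> * of_real (- cot_at B D A) * (A - D)"
    unfolding of_real_minus by algebra
  then have "D' = bisector_point D A (- cot_at B D A)"
    unfolding A'(2) bisector_point_move by simp
  then have "(dist D' A)\<^sup>2 = (dist A' A)\<^sup>2"
    unfolding A'(2) by (simp add: dist_bisector_point)
  then have 2: "dist A D' = dist A A'"
    by (simp add: dist_commute)
  have "cross (D' - B') (A' - B') \<noteq> 0"
    using nondegenerate_pb_step[OF assms(1,2)]
    by (auto simp: nondegenerate_iff_vcross vcross_def cross_def defs algebra_simps)
  from circumcenter_eqI[OF this 2 1] show ?thesis
    by (simp add: pb_step_def[of "pb_step Q"] flip: defs)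
qed

text \<open>A map \<open>X \<mapsto> r X + t\<close> with \<open>r \<noteq> 1\<close> has a fixed point; for \<open>r = 1\<close> it fixes \<open>A\<close>, so it is the identity
  and any point serves as the center.\<close>

lemma two_steps_homothety:
  assumes "nondegenerate Q" "\<not> cyclic Q"
  shows "\<exists>W. pb_step (pb_step Q) = map_quad (homothety W (step_ratio Q)) Q"
proof -
  let ?r = "of_real (step_ratio Q) :: complex"
  define t where "t = vA (pb_step (pb_step Q)) - ?r * vA Q"
  have "\<exists>W. (\<lambda>X. ?r * X + t) = homothety W (step_ratio Q)"
  proof (cases "step_ratio Q = 1")
    case True
    then have "t = 0"
      using two_steps_fix_vertex[OF assms] by (simp add: t_def)
    then show ?thesis
      using True by (simp add: homothety_def fun_eq_iff)
  next
    case False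
    then have "?r \<noteq> 1" by simp
    then have t: "t = (1 - ?r) * (t / (1 - ?r))" by simp
    have "?r * X + t = homothety (t / (1 - ?r)) (step_ratio Q) X" for X
      using t unfolding homothety_def by algebra
    then show ?thesis by blast
  qed
  then show ?thesis
    using two_steps_translate[OF assms] unfolding t_def by metis
qed

section \<open>Interior angles and directed angles\<close>

text \<open>The sense of traversal that an interior angle assumes; the value at area zero follows the
  definition of interior angles.\<close>

definition orientation :: "complex quad \<Rightarrow> real" where
  "orientation Q = (if signed_area Q > 0 then 1 else - 1)"

lemma signed_area_eq_vcross:
  "signed_area Q = (vcross Q + vcross (shift_quad (shift_quad Q))) / 2"
  by (simp add: signed_area_def vcross_def cross_def algebra_simps)

lemma signed_area_shift: "signed_area (shift_quad Q) = signed_area Q"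
  by (simp add: signed_area_def)

lemma orientation_shift: "orientation (shift_quad Q) = orientation Q"
  by (simp add: orientation_def signed_area_shift)

lemma angle_shift:
  "angle_B Q = angle_A (shift_quad Q)"
  "angle_C Q = angle_A (shift_quad (shift_quad Q))"
  "angle_D Q = angle_A (shift_quad (shift_quad (shift_quad Q)))"
  by (simp_all add: angle_A_def angle_B_def angle_C_def angle_D_def interior_angle_def
      signed_area_shift)

text \<open>The quotient of the two sides at \<open>A\<close> and this complex number differ by a positive factor.\<close>

lemma angle_A_eq_Arg2pi:
  assumes "vcross Q \<noteq> 0"
  shows "angle_A Q = Arg2pi (Complex (vdot Q) (orientation Q * vcross Q))"
proof -
  have "w * cnj z = Complex (z \<bullet> w) (cross z w)" for z w
    by (simp add: complex_eq_iff inner_complex_def cross_def algebra_simps)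
  \<comment> \<open>for \<open>z = 0\<close> both sides are \<open>0\<close>\<close>
  then have quot: "w / z = of_real (1 / (cmod z)\<^sup>2) * Complex (z \<bullet> w) (cross z w)" for z w
    by (simp add: complex_div_cnj[of w z])
  have arg: "Arg2pi (w / z) = Arg2pi (Complex (z \<bullet> w) (cross z w))" if "z \<noteq> 0" for z w
    unfolding quot using that by (intro Arg2pi_times_of_real) simp
  have nz: "vB Q - vA Q \<noteq> 0" "vD Q - vA Q \<noteq> 0"
    using assms by (auto simp: vcross_def cross_def)
  have anti: "cross v u = - cross u v" for u v
    by (simp add: cross_def algebra_simps)
  show ?thesis
    using nz unfolding angle_A_def interior_angle_def directed_angle_def orientation_def
    by (simp add: arg vdot_def vcross_def inner_commute[of "vD Q - vA Q"]
        anti[of "vD Q - vA Q" "vB Q - vA Q"])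
qed

lemma cot_Arg2pi:
  assumes "z \<noteq> 0"
  shows "cot (Arg2pi z) = Re z / Im z"
proof -
  have "cot (Arg2pi z) = (cmod z * cos (Arg2pi z)) / (cmod z * sin (Arg2pi z))"
    using assms by (simp add: cot_def)
  then show ?thesis
    by (simp only: cos_Arg2pi sin_Arg2pi)
qed

text \<open>Reversing the orientation changes the sign of all four cotangents. A product of two sums of
  cotangents, such as the ratio of similarity, is not affected.\<close>

lemma cot_angle_A:
  assumes "vcross Q \<noteq> 0"
  shows "cot (angle_A Q) = orientation Q * vcot Q"
proof -
  have "Complex (vdot Q) (orientation Q * vcross Q) \<noteq> 0"
    using assms by (simp add: complex_eq_iff orientation_def)
  then show ?thesis
    by (simp add: angle_A_eq_Arg2pi[OF assms] cot_Arg2pi vcot_def orientation_def)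
qed

lemma angle_A_compare_pi:
  assumes "vcross Q \<noteq> 0"
  shows "angle_A Q < pi \<Longrightarrow> orientation Q * vcross Q > 0"
    and "angle_A Q > pi \<Longrightarrow> orientation Q * vcross Q < 0"
proof -
  let ?z = "Complex (vdot Q) (orientation Q * vcross Q)"
  have nz: "Im ?z \<noteq> 0"
    using assms by (simp add: orientation_def)
  then have "?z \<notin> \<real>"
    by (simp add: complex_is_Real_iff)
  then have "Arg2pi ?z \<noteq> 0"
    by (auto simp: Arg2pi_eq_0)
  then have pos: "0 < Arg2pi ?z"
    using Arg2pi_ge_0[of ?z] by linarith
  show "angle_A Q < pi \<Longrightarrow> orientation Q * vcross Q > 0"
    using pos Arg2pi_lt_pi[of ?z] by (simp add: angle_A_eq_Arg2pi[OF assms])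
  show "angle_A Q > pi \<Longrightarrow> orientation Q * vcross Q < 0"
    using nz Arg2pi_le_pi[of ?z] by (simp add: angle_A_eq_Arg2pi[OF assms])
qed

text \<open>Both supplementary angle statements, modulo \<open>\<pi>\<close> and exact, come from here: the quotients of sides
  of the two generations at corresponding vertices have a real product.\<close>

lemma Arg2pi_add_multiple_of_pi:
  assumes "z \<noteq> 0" "w \<noteq> 0" "Im (z * w) = 0"
  obtains n :: int where "Arg2pi z + Arg2pi w = of_int n * pi"
proof -
  have "cmod z * cmod w * sin (Arg2pi z + Arg2pi w) =
      (cmod z * sin (Arg2pi z)) * (cmod w * cos (Arg2pi w)) +
      (cmod z * cos (Arg2pi z)) * (cmod w * sin (Arg2pi w))"
    by (simp add: sin_add algebra_simps)
  also have "\<dots> = Im (z * w)"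
    unfolding cos_Arg2pi sin_Arg2pi by (simp add: algebra_simps)
  finally have "sin (Arg2pi z + Arg2pi w) = 0"
    using assms by simp
  then show ?thesis
    using that by (auto simp: sin_zero_iff_int2)
qed

lemma directed_angles_supplementary:
  assumes "nondegenerate Q" "\<not> cyclic Q"
  shows "[directed_angle (vB Q) (vA Q) (vD Q) +
    directed_angle (vD (pb_step Q)) (vA (pb_step Q)) (vB (pb_step Q)) = pi] (rmod pi)"
proof -
  define z where "z = (vD Q - vA Q) / (vB Q - vA Q)"
  define w where "w = (vB (pb_step Q) - vA (pb_step Q)) / (vD (pb_step Q) - vA (pb_step Q))"
  have nz: "vB Q - vA Q \<noteq> 0" "vD Q - vA Q \<noteq> 0"
    using assms(1) by (auto simp: nondegenerate_iff_vcross vcross_def cross_def)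
  define s t where "s = side_ratio Q" and "t = side_ratio (shift_quad (shift_quad (shift_quad Q)))"
  have st: "s \<noteq> 0" "t \<noteq> 0"
    using assms by (simp_all add: s_def t_def side_ratio_nonzero cyclic_shift)
  have w: "w = (\<i> * of_real s * (vB Q - vA Q)) / (\<i> * of_real t * (vD Q - vA Q))"
    unfolding w_def pb_step_side_AB[OF assms(1)] pb_step_side_AD[OF assms(1)] s_def t_def ..
  have "z * w = of_real (s / t)"
    unfolding w z_def of_real_divide using nz st by (simp only: divide_simps) simp
  then have "Im (z * w) = 0"
    by simp
  moreover have "z \<noteq> 0" "w \<noteq> 0"
    using nz st by (simp_all add: z_def w)
  ultimately obtain n :: int where "Arg2pi z + Arg2pi w = of_int n * pi"
    using Arg2pi_add_multiple_of_pi by blast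
  then have "pi = Arg2pi z + Arg2pi w + of_int (1 - n) * pi"
    by (simp add: algebra_simps)
  then show ?thesis
    unfolding directed_angle_def z_def w_def rcong_altdef by blast
qed

text \<open>Cross products are easier to follow through the construction than angles, and for this purpose
  their signs carry all that convexity says.\<close>

definition vertices_convex :: "complex quad \<Rightarrow> bool" where
  "vertices_convex Q \<longleftrightarrow>
     orientation Q * vcross Q > 0 \<and> orientation Q * vcross (shift_quad Q) > 0 \<and>
     orientation Q * vcross (shift_quad (shift_quad Q)) > 0 \<and>
     orientation Q * vcross (shift_quad (shift_quad (shift_quad Q))) > 0"

lemma vertices_convex_shift: "vertices_convex (shift_quad Q) \<longleftrightarrow> vertices_convex Q"
  by (auto simp: vertices_convex_def orientation_shift)

lemma convex_imp_vertices_convex: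
  assumes "nondegenerate Q" "convex_quad Q"
  shows "vertices_convex Q"
proof -
  have "orientation R * vcross R > 0" if "nondegenerate R" "angle_A R < pi" for R
    using that angle_A_compare_pi(1)[of R] by (simp add: nondegenerate_iff_vcross)
  from this[of Q] this[of "shift_quad Q"] this[of "shift_quad (shift_quad Q)"]
    this[of "shift_quad (shift_quad (shift_quad Q))"]
  show ?thesis
    using assms by (simp add: vertices_convex_def convex_quad_def angle_shift orientation_shift)
qed

text \<open>The defects of a quadrilateral and of its shift are opposite, so the product of the two ratios is
  minus a square over the two areas.\<close>

lemma adjacent_side_ratios_opposite:
  assumes "nondegenerate Q" "\<not> cyclic Q"
    and "vcross (shift_quad Q) * vcross (shift_quad (shift_quad (shift_quad Q))) > 0"
  shows "side_ratio Q * side_ratio (shift_quad (shift_quad (shift_quad Q))) < 0"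
proof -
  let ?k = "vcross (shift_quad Q) * vcross (shift_quad (shift_quad (shift_quad Q)))"
  have "side_ratio Q * side_ratio (shift_quad (shift_quad (shift_quad Q))) =
      - ((cyclic_defect Q / (2 * vcross Q))\<^sup>2 / ?k)"
    by (simp add: side_ratio_def cyclic_defect_shift power2_eq_square)
  moreover have "cyclic_defect Q / (2 * vcross Q) \<noteq> 0"
    using assms by (simp add: cyclic_iff_no_defect nondegenerate_iff_vcross)
  ultimately show ?thesis
    using assms(3) by (simp del: divide_eq_0_iff times_divide_eq_left)
qed

text \<open>Opposite signs of adjacent side ratios turn every triangle of consecutive vertices over.\<close>

lemma orientation_pb_step:
  assumes "nondegenerate Q" "\<not> cyclic Q" "vertices_convex Q"
  shows "orientation (pb_step Q) = - orientation Q"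
proof -
  have same: "vcross (shift_quad Q) * vcross (shift_quad (shift_quad (shift_quad Q))) > 0"
    "vcross (shift_quad (shift_quad Q)) * vcross Q > 0"
    using assms(3) by (auto simp: vertices_convex_def orientation_def mult_neg_neg split: if_splits)
  define m where "m = side_ratio Q * side_ratio (shift_quad (shift_quad (shift_quad Q)))"
  define m' where "m' = side_ratio (shift_quad (shift_quad Q)) * side_ratio (shift_quad Q)"
  have m: "m < 0"
    unfolding m_def using assms same by (intro adjacent_side_ratios_opposite)
  have m': "m' < 0"
    unfolding m'_def
    using adjacent_side_ratios_opposite[of "shift_quad (shift_quad Q)"] assms same
    by (simp add: cyclic_shift mult.commute)
  have area: "signed_area (pb_step Q) =
      (m * vcross Q + m' * vcross (shift_quad (shift_quad Q))) / 2"
    using assms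
    by (simp add: signed_area_eq_vcross vcross_pb_step m_def m'_def flip: pb_step_shift)
  show ?thesis
  proof (cases "signed_area Q > 0")
    case True
    then have "m * vcross Q < 0" "m' * vcross (shift_quad (shift_quad Q)) < 0"
      using assms(3) m m' by (simp_all add: vertices_convex_def orientation_def mult_neg_pos)
    then show ?thesis
      using True by (simp add: orientation_def area)
  next
    case False
    then have "m * vcross Q > 0" "m' * vcross (shift_quad (shift_quad Q)) > 0"
      using assms(3) m m' by (simp_all add: vertices_convex_def orientation_def mult_neg_neg)
    then show ?thesis
      using False by (simp add: orientation_def area)
  qed
qed

text \<open>Both angles lie strictly between \<open>0\<close> and \<open>\<pi>\<close>, and their sum is a multiple of \<open>\<pi>\<close>.\<close>

lemma angles_supplementary:
  assumes "nondegenerate Q" "\<not> cyclic Q" "vertices_convex Q"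
  shows "angle_A Q + angle_A (pb_step Q) = pi"
proof -
  define m where "m = side_ratio Q * side_ratio (shift_quad (shift_quad (shift_quad Q)))"
  define z w where "z = Complex (vdot Q) (orientation Q * vcross Q)"
    and "w = Complex (m * vdot Q) (- (orientation Q * (m * vcross Q)))"
  have "vcross (shift_quad Q) * vcross (shift_quad (shift_quad (shift_quad Q))) > 0"
    using assms(3) by (auto simp: vertices_convex_def orientation_def mult_neg_neg split: if_splits)
  then have m: "m < 0"
    unfolding m_def using assms by (intro adjacent_side_ratios_opposite)
  have pos: "Im z > 0" "Im w > 0"
    using assms(3) m mult_neg_pos[of m "orientation Q * vcross Q"]
    by (auto simp: z_def w_def vertices_convex_def algebra_simps)
  then have "z \<noteq> 0" "w \<noteq> 0"
    by auto
  moreover have "Im (z * w) = 0"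
    by (simp add: z_def w_def)
  ultimately obtain n :: int where n: "Arg2pi z + Arg2pi w = of_int n * pi"
    using Arg2pi_add_multiple_of_pi by blast
  have "0 < Arg2pi z" "Arg2pi z < pi" "0 < Arg2pi w" "Arg2pi w < pi"
    using pos Arg2pi_lt_pi by blast+
  then have "0 * pi < of_int n * pi" "of_int n * pi < 2 * pi"
    unfolding n[symmetric] by linarith+
  then have "0 < (of_int n :: real)" "(of_int n :: real) < 2"
    by (simp_all only: mult_less_cancel_right_pos[OF pi_gt_zero])
  then have "n = 1"
    by linarith
  moreover have "angle_A Q = Arg2pi z"
    unfolding z_def using assms(1) by (intro angle_A_eq_Arg2pi) (simp add: nondegenerate_iff_vcross)
  moreover have "angle_A (pb_step Q) = Arg2pi w"
    using angle_A_eq_Arg2pi[of "pb_step Q"] nondegenerate_pb_step[OF assms(1,2)] assms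
    by (simp add: nondegenerate_iff_vcross[of "pb_step Q"] w_def m_def vcross_pb_step vdot_pb_step
        orientation_pb_step)
  ultimately show ?thesis
    using n by simp
qed

section \<open>The sign of the ratio\<close>

lemma step_ratio_eq_defect:
  "step_ratio Q = - ((cyclic_defect Q / 2)\<^sup>2 / (vcross Q * vcross (shift_quad Q) *
     vcross (shift_quad (shift_quad Q)) * vcross (shift_quad (shift_quad (shift_quad Q)))))"
  by (simp add: step_ratio_def side_ratio_def cyclic_defect_shift power2_eq_square)

lemma step_ratio_neg_if_vertices_convex:
  assumes "nondegenerate Q" "\<not> cyclic Q" "vertices_convex Q"
  shows "step_ratio Q < 0"
proof -
  have "vcross Q * vcross (shift_quad Q) *
     vcross (shift_quad (shift_quad Q)) * vcross (shift_quad (shift_quad (shift_quad Q))) > 0"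
    using assms(3)
    by (auto simp: vertices_convex_def orientation_def zero_less_mult_iff mult_less_0_iff
        split: if_splits)
  moreover have "(cyclic_defect Q / 2)\<^sup>2 > 0"
    using assms by (simp add: cyclic_iff_no_defect)
  ultimately show ?thesis
    unfolding step_ratio_eq_defect by simp
qed

text \<open>If \<open>C\<close> and \<open>D\<close> are separated by the line \<open>AB\<close>, and \<open>A\<close> and \<open>B\<close> by the line \<open>CD\<close>, then the two
  segments cross. The crossing point is explicit: the affine dependency of the four vertices, whose
  coefficients are the cross products, can be read as an equality of two convex combinations.\<close>

lemma opposite_sides_meet:
  assumes "vcross Q * vcross (shift_quad Q) < 0"
    and "vcross (shift_quad (shift_quad Q)) * vcross (shift_quad (shift_quad (shift_quad Q))) < 0"
  shows "closed_segment (vA Q) (vB Q) \<inter> closed_segment (vC Q) (vD Q) \<noteq> {}"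
proof -
  define k0 k1 k2 k3 where k: "k0 = vcross Q" "k1 = vcross (shift_quad Q)"
    "k2 = vcross (shift_quad (shift_quad Q))"
    "k3 = vcross (shift_quad (shift_quad (shift_quad Q)))"
  have sgn: "k0 * k1 < 0" "k2 * k3 < 0"
    using assms by (simp_all add: k)
  have den: "k0 - k1 = k3 - k2"
    using vcross_alternating_sums[of Q] by (simp add: k)
  have rel: "k3 *\<^sub>R vB Q - k2 *\<^sub>R vA Q = k0 *\<^sub>R vC Q - k1 *\<^sub>R vD Q"
  proof -
    have "k3 * Re (vB Q) - k2 * Re (vA Q) = k0 * Re (vC Q) - k1 * Re (vD Q)"
      "k3 * Im (vB Q) - k2 * Im (vA Q) = k0 * Im (vC Q) - k1 * Im (vD Q)"
      unfolding k vcross_def cross_def shift_quad_sel minus_complex.sel by algebra+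
    then show ?thesis
      by (simp add: complex_eq_iff)
  qed
  have nz: "k3 - k2 \<noteq> 0" "k0 - k1 \<noteq> 0"
    using sgn by (auto simp: mult_less_0_iff)
  define P where "P = (1 / (k3 - k2)) *\<^sub>R (k3 *\<^sub>R vB Q - k2 *\<^sub>R vA Q)"
  have seg: "(1 / (b - a)) *\<^sub>R (b *\<^sub>R Y - a *\<^sub>R X) \<in> closed_segment X Y"
    if "a * b < 0" for a b :: real and X Y :: complex
  proof -
    have "b / (b - a) \<in> {0..1}" "1 - b / (b - a) = - a / (b - a)"
      using that by (auto simp: mult_less_0_iff divide_simps)
    moreover have "(1 / (b - a)) *\<^sub>R (b *\<^sub>R Y - a *\<^sub>R X) =
        (1 - b / (b - a)) *\<^sub>R X + (b / (b - a)) *\<^sub>R Y"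
      unfolding \<open>1 - b / (b - a) = _\<close> by (simp add: algebra_simps)
    ultimately show ?thesis
      unfolding closed_segment_def by force
  qed
  have "P \<in> closed_segment (vA Q) (vB Q)"
    unfolding P_def using sgn by (intro seg)
  moreover have "P \<in> closed_segment (vD Q) (vC Q)"
    unfolding P_def rel den[symmetric] using sgn by (intro seg) (simp add: mult.commute)
  ultimately show ?thesis
    by (auto simp: closed_segment_commute)
qed

text \<open>The cross products at opposite vertices have the same sum for both pairs, which rules out that
  exactly one pair of opposite vertices is negative. If exactly two adjacent ones are negative, two
  sides cross. If all have the same sign, it is the sign of the area and no vertex is reflex. What
  remains is an odd number of negative ones.\<close>

lemma concave_imp_vcross_product_neg:
  assumes "nondegenerate Q" "concave_quad Q"
  shows "vcross Q * vcross (shift_quad Q) *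
     vcross (shift_quad (shift_quad Q)) * vcross (shift_quad (shift_quad (shift_quad Q))) < 0"
proof -
  define k0 k1 k2 k3 where k: "k0 = vcross Q" "k1 = vcross (shift_quad Q)"
    "k2 = vcross (shift_quad (shift_quad Q))"
    "k3 = vcross (shift_quad (shift_quad (shift_quad Q)))"
  have nz: "k0 \<noteq> 0" "k1 \<noteq> 0" "k2 \<noteq> 0" "k3 \<noteq> 0"
    using assms by (auto simp: nondegenerate_iff_vcross k)
  have simple: "simple_quad Q"
    using assms by (simp add: concave_quad_def)
  have "\<not> (k0 * k1 < 0 \<and> k2 * k3 < 0)"
    using simple opposite_sides_meet[of Q] by (auto simp: simple_quad_def k)
  moreover have "\<not> (k1 * k2 < 0 \<and> k3 * k0 < 0)"
    using simple opposite_sides_meet[of "shift_quad Q"] by (auto simp: simple_quad_def k)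
  moreover have sum: "k0 + k2 = k1 + k3"
    using vcross_alternating_sums by (simp add: k)
  moreover have "\<not> vertices_convex Q"
  proof -
    have "\<not> (orientation R * vcross R > 0)" if "nondegenerate R" "angle_A R > pi" for R
      using that angle_A_compare_pi(2)[of R] by (simp add: nondegenerate_iff_vcross)
    from this[of Q] this[of "shift_quad Q"] this[of "shift_quad (shift_quad Q)"]
      this[of "shift_quad (shift_quad (shift_quad Q))"]
    show ?thesis
      using assms by (auto simp: vertices_convex_def concave_quad_def angle_shift orientation_shift)
  qed
  then have "\<not> (0 < k0 \<and> 0 < k1 \<and> 0 < k2 \<and> 0 < k3)" "\<not> (k0 < 0 \<and> k1 < 0 \<and> k2 < 0 \<and> k3 < 0)"
    by (auto simp: vertices_convex_def orientation_def signed_area_eq_vcross k)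
  moreover from nz have "k0 < 0 \<or> k0 > 0" "k1 < 0 \<or> k1 > 0" "k2 < 0 \<or> k2 > 0" "k3 < 0 \<or> k3 > 0"
    by linarith+
  ultimately have "k0 * k1 * k2 * k3 < 0"
    by (elim disjE) (linarith | simp add: mult_less_0_iff zero_less_mult_iff)+
  then show ?thesis
    by (simp add: k)
qed

lemma step_ratio_pos_if_concave:
  assumes "nondegenerate Q" "\<not> cyclic Q" "concave_quad Q"
  shows "step_ratio Q > 0"
proof -
  have "(cyclic_defect Q / 2)\<^sup>2 > 0"
    using assms by (simp add: cyclic_iff_no_defect)
  then show ?thesis
    using concave_imp_vcross_product_neg[OF assms(1,3)]
    unfolding step_ratio_eq_defect by (simp only: divide_pos_neg neg_0_less_iff_less)
qed

lemma step_ratio_eq_cot: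
  assumes "nondegenerate Q"
  shows "step_ratio Q =
    1 / 4 * (cot (angle_A Q) + cot (angle_C Q)) * (cot (angle_B Q) + cot (angle_D Q))"
proof -
  have cot: "cot (angle_A R) = orientation R * vcot R" if "nondegenerate R" for R
    using that by (intro cot_angle_A) (simp add: nondegenerate_iff_vcross)
  have "cot (angle_A Q) = orientation Q * vcot Q"
    "cot (angle_B Q) = orientation Q * vcot (shift_quad Q)"
    "cot (angle_C Q) = orientation Q * vcot (shift_quad (shift_quad Q))"
    "cot (angle_D Q) = orientation Q * vcot (shift_quad (shift_quad (shift_quad Q)))"
    using assms by (simp_all add: angle_shift cot orientation_shift)
  moreover have "orientation Q * orientation Q = 1"
    by (simp add: orientation_def)
  ultimately show ?thesis
    unfolding step_ratio_eq_vcot[OF assms] by algebra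
qed

section \<open>Homotheties between generations\<close>

lemma dist_homothety: "dist (homothety W k X) (homothety W k Y) = \<bar>k\<bar> * dist X Y"
proof -
  have "homothety W k X - homothety W k Y = of_real k * (X - Y)"
    by (simp add: homothety_def algebra_simps)
  then show ?thesis
    by (simp add: dist_norm norm_mult)
qed

lemma circumcenter_homothety:
  assumes "k \<noteq> 0" "cross (X - Z) (Y - Z) \<noteq> 0"
  shows "circumcenter (homothety W k X) (homothety W k Y) (homothety W k Z) =
    homothety W k (circumcenter X Y Z)"
proof (rule circumcenter_eqI)
  have diff: "homothety W k X - homothety W k Z = of_real k * (X - Z)" for X
    by (simp add: homothety_def algebra_simps)
  have "cross (of_real k * u) (of_real k * v) = k\<^sup>2 * cross u v" for u v
    by (simp add: cross_def power2_eq_square algebra_simps)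
  then show "cross (homothety W k X - homothety W k Z) (homothety W k Y - homothety W k Z) \<noteq> 0"
    unfolding diff using assms by simp
qed (simp_all add: dist_homothety circumcenter_equidistant[OF assms(2)])

lemma pb_step_homothety:
  assumes "nondegenerate Q" "k \<noteq> 0"
  shows "pb_step (map_quad (homothety W k) Q) = map_quad (homothety W k) (pb_step Q)"
proof -
  have nz: "cross (vD Q - vB Q) (vA Q - vB Q) \<noteq> 0" "cross (vA Q - vC Q) (vB Q - vC Q) \<noteq> 0"
    "cross (vB Q - vD Q) (vC Q - vD Q) \<noteq> 0" "cross (vC Q - vA Q) (vD Q - vA Q) \<noteq> 0"
    using assms(1) by (auto simp: nondegenerate_iff_vcross vcross_def cross_def algebra_simps)
  show ?thesis
    by (simp add: pb_step_def quad.map_sel circumcenter_homothety[OF assms(2) nz(1)]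
        circumcenter_homothety[OF assms(2) nz(2)] circumcenter_homothety[OF assms(2) nz(3)]
        circumcenter_homothety[OF assms(2) nz(4)])
qed

lemma map_homothety_homothety:
  "map_quad (homothety W k) (map_quad (homothety W l) Q) = map_quad (homothety W (k * l)) Q"
proof -
  have "homothety W k \<circ> homothety W l = homothety W (k * l)"
    by (simp add: fun_eq_iff homothety_def mult.assoc)
  then show ?thesis
    by (simp add: quad.map_comp)
qed

lemma map_homothety_1 [simp]: "map_quad (homothety W 1) Q = Q"
  by (cases Q) (simp add: homothety_def)

lemma homothety_eq_spiral_similarity:
  "k \<ge> 0 \<Longrightarrow> homothety W k = spiral_similarity W \<bar>k\<bar> 0"
  "k \<le> 0 \<Longrightarrow> homothety W k = spiral_similarity W \<bar>k\<bar> pi"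
  by (simp_all add: fun_eq_iff spiral_similarity_def homothety_def rotation_def algebra_simps)

lemma plane_similarity_homothety: "k \<noteq> 0 \<Longrightarrow> plane_similarity (homothety W k)"
  unfolding plane_similarity_def using dist_homothety by (metis zero_less_abs_iff)

lemma not_cyclic_pb_step:
  assumes "nondegenerate Q" "\<not> cyclic Q"
  shows "\<not> cyclic (pb_step Q)"
proof -
  have "cyclic_defect Q \<noteq> 0"
    using assms cyclic_iff_no_defect by blast
  then have "cyclic_defect (pb_step Q) \<noteq> 0"
    using assms by (simp add: cyclic_defect_pb_step side_ratio_nonzero cyclic_shift)
  then show ?thesis
    using cyclic_iff_no_defect[OF nondegenerate_pb_step[OF assms]] by blast
qed

lemma generations_noncyclic:
  fixes Q :: "nat \<Rightarrow> complex quad"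
  assumes "nondegenerate (Q 1)" "\<not> cyclic (Q 1)"
    and "\<And>n. n \<ge> 1 \<Longrightarrow> Q (n + 1) = pb_step (Q n)" and "n \<ge> 1"
  shows "nondegenerate (Q n)" "\<not> cyclic (Q n)"
proof -
  have "nondegenerate (Q n) \<and> \<not> cyclic (Q n)"
    using \<open>n \<ge> 1\<close>
  proof (induction n rule: dec_induct)
    case (step n)
    then show ?case
      using assms(3)[of n] nondegenerate_pb_step not_cyclic_pb_step by simp
  qed (use assms in auto)
  then show "nondegenerate (Q n)" "\<not> cyclic (Q n)"
    by auto
qed

text \<open>The construction commutes with the homothety that takes \<open>Q 1\<close> to \<open>Q 3\<close>, so by induction the same
  homothety advances every generation by two. In particular, both parities have one center.\<close>

lemma generations_homothetic:
  fixes Q :: "nat \<Rightarrow> complex quad"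
  assumes "nondegenerate (Q 1)" "\<not> cyclic (Q 1)"
    and step: "\<And>n. n \<ge> 1 \<Longrightarrow> Q (n + 1) = pb_step (Q n)"
  obtains W where
    "\<And>n. n \<ge> 1 \<Longrightarrow> Q (n + 2) = map_quad (homothety W (step_ratio (Q 1))) (Q n)"
proof -
  define r where "r = step_ratio (Q 1)"
  have r: "r \<noteq> 0"
    using assms by (simp add: r_def step_ratio_def side_ratio_nonzero cyclic_shift)
  have nd: "nondegenerate (Q n)" if "n \<ge> 1" for n
    using generations_noncyclic[of Q n] assms that by blast
  obtain W where W: "pb_step (pb_step (Q 1)) = map_quad (homothety W r) (Q 1)"
    using two_steps_homothety[OF assms(1,2)] unfolding r_def by blast
  have "Q (n + 2) = map_quad (homothety W r) (Q n)" if "n \<ge> 1" for n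
    using that
  proof (induction n rule: dec_induct)
    case base
    then show ?case
      using W step[of 1] step[of 2] by (simp add: numeral_eq_Suc)
  next
    case (step n)
    then show ?case
      using assms(3)[of n] assms(3)[of "n + 2"] pb_step_homothety[of "Q n" r W] nd[of n] r by simp
  qed
  then show ?thesis
    using that unfolding r_def by blast
qed

lemma same_parity_homothetic:
  fixes Q :: "nat \<Rightarrow> complex quad"
  assumes two: "\<And>n. n \<ge> 1 \<Longrightarrow> Q (n + 2) = map_quad (homothety W r) (Q n)"
    and r: "r \<noteq> 0" and mn: "m \<ge> 1" "n \<ge> 1" "even m \<longleftrightarrow> even n"
  shows "\<exists>k. k \<noteq> 0 \<and> map_quad (homothety W k) (Q m) = Q n"
proof -
  have iter: "Q (m + 2 * j) = map_quad (homothety W (r ^ j)) (Q m)" if "m \<ge> 1" for m j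
  proof (induction j)
    case (Suc j)
    then show ?case
      using two[of "m + 2 * j"] that by (simp add: map_homothety_homothety)
  qed simp
  show ?thesis
  proof (cases "m \<le> n")
    case True
    then have "even (n - m)" using mn by simp
    then obtain j where "n = m + 2 * j" using True by (metis evenE le_add_diff_inverse)
    then show ?thesis
      using iter[of m j] mn r by (intro exI[of _ "r ^ j"]) simp
  next
    case False
    then have "even (m - n)" using mn by simp
    then obtain j where "m = n + 2 * j" using False by (metis evenE le_add_diff_inverse nle_le)
    then have "map_quad (homothety W ((1 / r) ^ j)) (Q m) = Q n"
      using iter[of n j] mn r by (simp add: map_homothety_homothety power_one_over)
    then show ?thesis
      using r by (intro exI[of _ "(1 / r) ^ j"]) simp
  qed
qed

section \<open>The perpendicular bisector construction\<close>

theorem theorem2: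
  fixes Q :: "nat \<Rightarrow> complex quad" and \<alpha> \<beta> \<gamma> \<delta> r :: real
  assumes "nondegenerate (Q 1)"
    and "\<And>n. n \<ge> 1 \<Longrightarrow> Q (n + 1) = pb_step (Q n)"
    and "\<alpha> = angle_A (Q 1)" and "\<beta> = angle_B (Q 1)"
    and "\<gamma> = angle_C (Q 1)" and "\<delta> = angle_D (Q 1)"
    and "r = 1 / 4 * (cot \<alpha> + cot \<gamma>) * (cot \<beta> + cot \<delta>)"
  shows
    \<comment> \<open>(1)\<close>
    "((\<exists>P. Q 2 = Quad P P P P) \<longleftrightarrow> cyclic (Q 1)) \<and>
     (\<not> cyclic (Q 1) \<longrightarrow>
        \<comment> \<open>the construction never breaks down\<close>
        (\<forall>n\<ge>1. nondegenerate (Q n)) \<and>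
        \<comment> \<open>(2) for interior angles\<close>
        (convex_quad (Q 1) \<longrightarrow>
           angle_A (Q 1) + angle_A (Q 2) = pi \<and> angle_B (Q 1) + angle_B (Q 2) = pi \<and>
           angle_C (Q 1) + angle_C (Q 2) = pi \<and> angle_D (Q 1) + angle_D (Q 2) = pi) \<and>
        \<comment> \<open>(2) for directed angles modulo pi, the two generations being traversed in opposite senses;
            for interior angles of concave quadrilaterals the exact equation fails\<close>
        [directed_angle (vB (Q 1)) (vA (Q 1)) (vD (Q 1)) +
         directed_angle (vD (Q 2)) (vA (Q 2)) (vB (Q 2)) = pi] (rmod pi) \<and>
        [directed_angle (vC (Q 1)) (vB (Q 1)) (vA (Q 1)) +
         directed_angle (vA (Q 2)) (vB (Q 2)) (vC (Q 2)) = pi] (rmod pi) \<and>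
        [directed_angle (vD (Q 1)) (vC (Q 1)) (vB (Q 1)) +
         directed_angle (vB (Q 2)) (vC (Q 2)) (vD (Q 2)) = pi] (rmod pi) \<and>
        [directed_angle (vA (Q 1)) (vD (Q 1)) (vC (Q 1)) +
         directed_angle (vC (Q 2)) (vD (Q 2)) (vA (Q 2)) = pi] (rmod pi) \<and>
        \<comment> \<open>(3)\<close>
        (\<forall>m\<ge>1. \<forall>n\<ge>1. odd m \<and> odd n \<longrightarrow> similar_quad (Q m) (Q n)) \<and>
        (\<forall>m\<ge>1. \<forall>n\<ge>1. even m \<and> even n \<longrightarrow> similar_quad (Q m) (Q n)) \<and>
        \<comment> \<open>(7): one center serves both parities\<close>
        (\<exists>W.
           \<comment> \<open>(4)\<close>
           (\<forall>m\<ge>1. \<forall>n\<ge>1. odd m \<and> odd n \<longrightarrow>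
              (\<exists>k>0. \<exists>\<theta>. map_quad (spiral_similarity W k \<theta>) (Q m) = Q n)) \<and>
           \<comment> \<open>(5)\<close>
           (\<forall>m\<ge>1. \<forall>n\<ge>1. even m \<and> even n \<longrightarrow>
              (\<exists>k>0. \<exists>\<theta>. map_quad (spiral_similarity W k \<theta>) (Q m) = Q n)) \<and>
           \<comment> \<open>(6): the signed ratio is r, i.e. modulus and rotation by pi or 0 according to sign\<close>
           (convex_quad (Q 1) \<longrightarrow> r < 0 \<and>
              (\<forall>n\<ge>1. map_quad (spiral_similarity W \<bar>r\<bar> pi) (Q n) = Q (n + 2))) \<and>
           (concave_quad (Q 1) \<longrightarrow> r > 0 \<and>
              (\<forall>n\<ge>1. map_quad (spiral_similarity W \<bar>r\<bar> 0) (Q n) = Q (n + 2)))))"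
proof -
  note nd = assms(1)
  note step = assms(2)
  have Q2: "Q 2 = pb_step (Q 1)"
    using step[of 1] by (simp add: numeral_eq_Suc)
  have point: "(\<exists>P. Q 2 = Quad P P P P) \<longleftrightarrow> cyclic (Q 1)"
    unfolding Q2 using pb_step_point_if_cyclic[OF nd] cyclic_if_pb_step_point[OF nd] by blast
  have r: "r = step_ratio (Q 1)"
    using assms(3-7) step_ratio_eq_cot[OF nd] by simp
  show ?thesis
  proof (intro conjI[OF point] impI)
    assume nc: "\<not> cyclic (Q 1)"
    let ?S1 = "shift_quad (Q 1)" and ?S2 = "shift_quad (shift_quad (Q 1))"
      and ?S3 = "shift_quad (shift_quad (shift_quad (Q 1)))"
    have r0: "r \<noteq> 0"
      using nd nc by (simp add: r step_ratio_def side_ratio_nonzero cyclic_shift)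
    obtain W where W: "\<And>n. n \<ge> 1 \<Longrightarrow> Q (n + 2) = map_quad (homothety W r) (Q n)"
      using generations_homothetic[of Q] nd nc step unfolding r by blast
    have homothetic: "\<exists>k. k \<noteq> 0 \<and> map_quad (homothety W k) (Q m) = Q n"
      if "m \<ge> 1" "n \<ge> 1" "even m \<longleftrightarrow> even n" for m n
      using same_parity_homothetic[of Q W r m n] W r0 that by blast
    have similar: "similar_quad (Q m) (Q n)"
      if "m \<ge> 1" "n \<ge> 1" "even m \<longleftrightarrow> even n" for m n
      using homothetic[OF that] plane_similarity_homothety unfolding similar_quad_def by blast
    have spiral: "\<exists>k>0. \<exists>\<theta>. map_quad (spiral_similarity W k \<theta>) (Q m) = Q n"
      if mn: "m \<ge> 1" "n \<ge> 1" "even m \<longleftrightarrow> even n" for m n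
    proof -
      obtain k where k: "k \<noteq> 0" "map_quad (homothety W k) (Q m) = Q n"
        using homothetic[OF mn] by blast
      have "\<exists>\<theta>. homothety W k = spiral_similarity W \<bar>k\<bar> \<theta>"
        using homothety_eq_spiral_similarity[of k W] linear[of 0 k] by blast
      moreover have "\<bar>k\<bar> > 0"
        using k(1) by simp
      ultimately show ?thesis
        using k(2) by metis
    qed
    have nondeg: "nondegenerate (Q n)" if "n \<ge> 1" for n
      using generations_noncyclic[of Q] nd nc step that by blast
    have interior: "angle_A (Q 1) + angle_A (Q 2) = pi \<and> angle_B (Q 1) + angle_B (Q 2) = pi \<and>
        angle_C (Q 1) + angle_C (Q 2) = pi \<and> angle_D (Q 1) + angle_D (Q 2) = pi"
      if "convex_quad (Q 1)"
      using convex_imp_vertices_convex[OF nd that] nd nc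
        angles_supplementary[of "Q 1"] angles_supplementary[of ?S1] angles_supplementary[of ?S2]
        angles_supplementary[of ?S3]
      by (simp add: Q2 angle_shift cyclic_shift vertices_convex_shift flip: pb_step_shift)
    have directed:
      "[directed_angle (vB (Q 1)) (vA (Q 1)) (vD (Q 1)) +
        directed_angle (vD (Q 2)) (vA (Q 2)) (vB (Q 2)) = pi] (rmod pi)"
      "[directed_angle (vC (Q 1)) (vB (Q 1)) (vA (Q 1)) +
        directed_angle (vA (Q 2)) (vB (Q 2)) (vC (Q 2)) = pi] (rmod pi)"
      "[directed_angle (vD (Q 1)) (vC (Q 1)) (vB (Q 1)) +
        directed_angle (vB (Q 2)) (vC (Q 2)) (vD (Q 2)) = pi] (rmod pi)"
      "[directed_angle (vA (Q 1)) (vD (Q 1)) (vC (Q 1)) +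
        directed_angle (vC (Q 2)) (vD (Q 2)) (vA (Q 2)) = pi] (rmod pi)"
      using nd nc directed_angles_supplementary[of "Q 1"] directed_angles_supplementary[of ?S1]
        directed_angles_supplementary[of ?S2] directed_angles_supplementary[of ?S3]
      unfolding Q2 by (simp_all add: cyclic_shift pb_step_shift)
    have convex: "r < 0 \<and> (\<forall>n\<ge>1. map_quad (spiral_similarity W \<bar>r\<bar> pi) (Q n) = Q (n + 2))"
      if "convex_quad (Q 1)"
    proof -
      have "r < 0"
        unfolding r using nd nc convex_imp_vertices_convex[OF nd that]
        by (rule step_ratio_neg_if_vertices_convex)
      then show ?thesis
        using W homothety_eq_spiral_similarity(2)[of r W] by simp
    qed
    have concave: "r > 0 \<and> (\<forall>n\<ge>1. map_quad (spiral_similarity W \<bar>r\<bar> 0) (Q n) = Q (n + 2))"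
      if "concave_quad (Q 1)"
    proof -
      have "r > 0"
        unfolding r using nd nc that by (rule step_ratio_pos_if_concave)
      then show ?thesis
        using W homothety_eq_spiral_similarity(1)[of r W] by simp
    qed
    show "(\<forall>n\<ge>1. nondegenerate (Q n)) \<and>
        (convex_quad (Q 1) \<longrightarrow>
           angle_A (Q 1) + angle_A (Q 2) = pi \<and> angle_B (Q 1) + angle_B (Q 2) = pi \<and>
           angle_C (Q 1) + angle_C (Q 2) = pi \<and> angle_D (Q 1) + angle_D (Q 2) = pi) \<and>
        [directed_angle (vB (Q 1)) (vA (Q 1)) (vD (Q 1)) +
         directed_angle (vD (Q 2)) (vA (Q 2)) (vB (Q 2)) = pi] (rmod pi) \<and>
        [directed_angle (vC (Q 1)) (vB (Q 1)) (vA (Q 1)) +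
         directed_angle (vA (Q 2)) (vB (Q 2)) (vC (Q 2)) = pi] (rmod pi) \<and>
        [directed_angle (vD (Q 1)) (vC (Q 1)) (vB (Q 1)) +
         directed_angle (vB (Q 2)) (vC (Q 2)) (vD (Q 2)) = pi] (rmod pi) \<and>
        [directed_angle (vA (Q 1)) (vD (Q 1)) (vC (Q 1)) +
         directed_angle (vC (Q 2)) (vD (Q 2)) (vA (Q 2)) = pi] (rmod pi) \<and>
        (\<forall>m\<ge>1. \<forall>n\<ge>1. odd m \<and> odd n \<longrightarrow> similar_quad (Q m) (Q n)) \<and>
        (\<forall>m\<ge>1. \<forall>n\<ge>1. even m \<and> even n \<longrightarrow> similar_quad (Q m) (Q n)) \<and>
        (\<exists>W.
           (\<forall>m\<ge>1. \<forall>n\<ge>1. odd m \<and> odd n \<longrightarrow>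
              (\<exists>k>0. \<exists>\<theta>. map_quad (spiral_similarity W k \<theta>) (Q m) = Q n)) \<and>
           (\<forall>m\<ge>1. \<forall>n\<ge>1. even m \<and> even n \<longrightarrow>
              (\<exists>k>0. \<exists>\<theta>. map_quad (spiral_similarity W k \<theta>) (Q m) = Q n)) \<and>
           (convex_quad (Q 1) \<longrightarrow> r < 0 \<and>
              (\<forall>n\<ge>1. map_quad (spiral_similarity W \<bar>r\<bar> pi) (Q n) = Q (n + 2))) \<and>
           (concave_quad (Q 1) \<longrightarrow> r > 0 \<and>
              (\<forall>n\<ge>1. map_quad (spiral_similarity W \<bar>r\<bar> 0) (Q n) = Q (n + 2))))"
      using nondeg interior directed similar
      by (intro conjI exI[of _ W] allI impI; simp add: spiral convex concave)
  qed
qed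

end
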